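(* Let $p_1<p_2$ be finite real numbers, let $f$ be a symbol with $f''>0$ as in the context, and let $u_0\in\mathcal S(\mathbb R)$ satisfy $\mathrm{supp}\,\mathcal F u_0\subseteq[p_1,p_2]$ and $\|u_0\|_{L^2(\mathbb R)}=1$. Let $(t_0,x_0)\in\mathbb R^2$. Then the following equivalence holds: $$\exists\,C\in\mathbb R\quad\forall\,t\in\mathbb R\setminus\{t_0\}\qquad\mathcal V\big(u_f(t,\cdot)\big)-\mathcal V\big(H_f(t,\cdot,u_0,t_0,x_0)\big)=C$$ $$\Longleftrightarrow\qquad t_0=t^*:=\operatorname*{arg\,min}_{\tau\in\mathbb R}\mathcal V\big(u_f(\tau,\cdot)\big).$$ In particular, in that case, $C=\min_{\tau\in\mathbb R}\mathcal V\big(u_f(\tau,\cdot)\big)$.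
   Context: Fourier transform: $\mathcal F u(p)=\int_{\mathbb R}u(x)e^{-ixp}\,dx$. The symbol $f:\mathbb R\to\mathbb R$ is $\mathcal C^\infty$, all its derivatives grow at most polynomially at infinity, and $f''>0$ on $\mathbb R$. The wave packet is $u_f(t,x)=\frac1{2\pi}\int_{\mathbb R}\mathcal F u_0(p)\,e^{-itf(p)+ixp}\,dp$. For $t\neq t_0$ and $x\in\mathbb R$, with $p_0(t,x):=(f')^{-1}\big(\frac{x-x_0}{t-t_0}\big)$, $$H_f(t,x,u_0,t_0,x_0):=\frac1{\sqrt{2\pi}}\,e^{-\mathrm{sgn}(t-t_0)i\frac\pi4}\,e^{-itf(p_0(t,x))+ixp_0(t,x)}\,\frac{\mathcal F u_0(p_0(t,x))}{\sqrt{f''(p_0(t,x))}}\,|t-t_0|^{-\frac12};$$ this function is supported in $\{(t,x):f'(p_1)\leqslant\frac{x-x_0}{t-t_0}\leqslant f'(p_2)\}$ and is understood to be $0$ where $\frac{x-x_0}{t-t_0}\notin f'(\mathbb R)$. For $u$ with $\|u\|_{L^2(\mathbb R)}=1$: $\mathcal M_1(u)=\int_{\mathbb R}x|u(x)|^2dx$, $\mathcal M_2(u)=\int_{\mathbb R}x^2|u(x)|^2dx$, $\mathcal V(u)=\mathcal M_2(u)-\mathcal M_1(u)^2$. *)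

theory Defs
  imports "HOL-Analysis.Analysis"
begin

definition symbol :: "(real \<Rightarrow> real) \<Rightarrow> bool" where
  "symbol f \<longleftrightarrow>
     (\<forall>n x. (deriv ^^ n) f differentiable (at x)) \<and>
     (\<forall>n. \<exists>C N. \<forall>x. \<bar>(deriv ^^ n) f x\<bar> \<le> C * (1 + \<bar>x\<bar>) ^ N) \<and>
     (\<forall>x. deriv (deriv f) x > 0)"

definition nth_vderiv :: "nat \<Rightarrow> (real \<Rightarrow> complex) \<Rightarrow> real \<Rightarrow> complex" where
  "nth_vderiv n u = ((\<lambda>v x. vector_derivative v (at x)) ^^ n) u"

definition schwartz :: "(real \<Rightarrow> complex) \<Rightarrow> bool" where
  "schwartz u \<longleftrightarrow>
     (\<forall>n x. nth_vderiv n u differentiable (at x)) \<and>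
     (\<forall>k n. bounded (range (\<lambda>x. x ^ k *\<^sub>R nth_vderiv n u x)))"

definition fourier :: "(real \<Rightarrow> complex) \<Rightarrow> real \<Rightarrow> complex" where
  "fourier u p = (LINT x|lborel. u x * cis (- (x * p)))"

definition supp :: "(real \<Rightarrow> complex) \<Rightarrow> real set" where
  "supp g = closure {p. g p \<noteq> 0}"

definition L2norm :: "(real \<Rightarrow> complex) \<Rightarrow> real" where
  "L2norm u = sqrt (LINT x|lborel. (cmod (u x))\<^sup>2)"

definition wave_packet ::
    "(real \<Rightarrow> real) \<Rightarrow> (real \<Rightarrow> complex) \<Rightarrow> real \<Rightarrow> real \<Rightarrow> complex" where
  "wave_packet f u0 t x =
     complex_of_real (1 / (2 * pi)) *
     (LINT p|lborel. fourier u0 p * cis (- (t * f p) + x * p))"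

text \<open>
  Under \<open>symbol f\<close> the map \<open>deriv f\<close> is injective, so \<open>inv (deriv f)\<close> is its genuine inverse on
  \<open>range (deriv f)\<close>; outside this range \<open>H\<close> is set to 0.  The value at \<open>t = t0\<close> is meaningless.
\<close>
definition H ::
    "(real \<Rightarrow> real) \<Rightarrow> real \<Rightarrow> real \<Rightarrow> (real \<Rightarrow> complex) \<Rightarrow> real \<Rightarrow> real \<Rightarrow> complex" where
  "H f t x u0 t0 x0 =
     (if (x - x0) / (t - t0) \<in> range (deriv f)
      then let p0 = inv (deriv f) ((x - x0) / (t - t0)) in
        complex_of_real (1 / sqrt (2 * pi)) *
        cis (- (sgn (t - t0) * (pi / 4))) *
        cis (- (t * f p0) + x * p0) *
        (fourier u0 p0 / complex_of_real (sqrt (deriv (deriv f) p0))) *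
        complex_of_real (\<bar>t - t0\<bar> powr (- 1 / 2))
      else 0)"

text \<open>
  The moments are meant for \<open>u\<close> with \<open>L2norm u = 1\<close> for which both integrands are integrable
  (the Bochner integral is 0 otherwise).  This holds for \<open>wave_packet f u0 t\<close> and, if \<open>t \<noteq> t0\<close>,
  for \<open>\<lambda>x. H f t x u0 t0 x0\<close>, whenever \<open>u0\<close> is a Schwartz function with \<open>L2norm u0 = 1\<close> and
  compactly supported Fourier transform.
\<close>
definition moment1 :: "(real \<Rightarrow> complex) \<Rightarrow> real" where
  "moment1 u = (LINT x|lborel. x * (cmod (u x))\<^sup>2)"

definition moment2 :: "(real \<Rightarrow> complex) \<Rightarrow> real" where
  "moment2 u = (LINT x|lborel. x\<^sup>2 * (cmod (u x))\<^sup>2)"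

definition variance :: "(real \<Rightarrow> complex) \<Rightarrow> real" where
  "variance u = moment2 u - (moment1 u)\<^sup>2"

end

theory Submission
  imports Defs "HOL-Probability.Probability"
begin

text \<open>
  Both variances are quadratic polynomials in \<open>t\<close> with the same leading coefficient, the variance
  \<open>\<sigma>\<close> of the velocity \<open>deriv f\<close> under the momentum density \<open>|g|\<^sup>2 / (2 * pi)\<close>, where \<open>g\<close> is the Fourier
  transform of the initial state. That density has mass 1 by the Plancherel identity, and \<open>\<sigma> > 0\<close>
  because \<open>deriv f\<close> is injective (\<open>velocity_variance_pos\<close>).

  For the wave packet, the spectrum at time \<open>t\<close> is \<open>g p * cis (- (t * f p))\<close>, and multiplication by \<open>x\<close>
  corresponds to differentiation of the spectrum. Each derivative of the phase produces a factor
  \<open>t * deriv f p\<close>, so the first and second moments are polynomials in \<open>t\<close> of degree 1 and 2, and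
  the variance is \<open>\<alpha> + 2 * t * \<beta> + t\<^sup>2 * \<sigma>\<close> (\<open>variance_wave_packet\<close>). It has a unique minimum, at
  \<open>- \<beta> / \<sigma>\<close>.

  The density \<open>|H|\<^sup>2\<close> is the momentum density transported along the rays
  \<open>x = x0 + (t - t0) * deriv f p\<close>, divided by the Jacobian \<open>|t - t0| * deriv (deriv f) p\<close> of this change
  of variables. The variance of \<open>H\<close> is exactly \<open>(t - t0)\<^sup>2 * \<sigma>\<close> (\<open>variance_H\<close>).

  The difference is thus affine in \<open>t\<close> with slope \<open>2 * (\<beta> + t0 * \<sigma>)\<close>. It is constant if and only if
  \<open>t0 = - \<beta> / \<sigma>\<close>, that is, if both parabolas have the same vertex; the constant is then the
  variance of the packet at \<open>t0\<close>, since that of \<open>H\<close> has vertex value 0.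

  The analytic work lies in the Plancherel identity (\<open>plancherel\<close>). It is proved for bounded
  continuous integrable functions by Gaussian regularisation.
\<close>

section \<open>The Plancherel identity\<close>

lemma borel_measurable_cis [measurable]: "cis \<in> borel_measurable borel"
  by (intro borel_measurable_continuous_onI continuous_intros)

lemma borel_measurable_cnj [measurable]: "cnj \<in> borel_measurable borel"
  by (intro borel_measurable_continuous_onI continuous_intros)

lemma has_vector_derivative_cis [derivative_intros]:
  assumes "(f has_real_derivative f') (at x within S)"
  shows "((\<lambda>x. cis (f x)) has_vector_derivative of_real f' * (\<i> * cis (f x))) (at x within S)"
proof -
  have "((\<lambda>x. exp (\<i> * complex_of_real (f x))) has_vector_derivative
      f' *\<^sub>R (\<i> * exp (\<i> * complex_of_real (f x)))) (at x within S)"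
    using vector_diff_chain_within[of f f' x S "\<lambda>x. exp (\<i> * complex_of_real x)"
        "\<i> * exp (\<i> * complex_of_real (f x))"] assms
    by (auto simp: o_def has_real_derivative_iff_has_vector_derivative
        intro: has_vector_derivative_iexp)
  then show ?thesis
    by (simp add: cis_conv_exp scaleR_conv_of_real)
qed

lemma integrable_bounded_mult:
  fixes f g :: "'a \<Rightarrow> complex"
  assumes f: "integrable M f" and g [measurable]: "g \<in> borel_measurable M"
    and b: "\<And>x. norm (g x) \<le> B"
  shows "integrable M (\<lambda>x. f x * g x)"
proof (rule Bochner_Integration.integrable_bound)
  show "integrable M (\<lambda>x. B *\<^sub>R f x)" using f by simp
  show "(\<lambda>x. f x * g x) \<in> borel_measurable M" using f by measurable
  show "AE x in M. norm (f x * g x) \<le> norm (B *\<^sub>R f x)"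
  proof (rule AE_I2)
    fix x
    have "norm (f x) * norm (g x) \<le> norm (f x) * \<bar>B\<bar>"
      using b[of x] by (intro mult_left_mono) auto
    then show "norm (f x * g x) \<le> norm (B *\<^sub>R f x)"
      by (simp add: norm_mult mult.commute)
  qed
qed

lemma integrable_mult_cis:
  assumes "integrable lborel f" and [measurable]: "h \<in> borel_measurable borel"
  shows "integrable lborel (\<lambda>x. f x * cis (h x))"
  by (rule integrable_bounded_mult[where B = 1]) (use assms in auto)

lemma borel_measurable_fourier [measurable]:
  assumes [measurable]: "\<phi> \<in> borel_measurable borel"
  shows "fourier \<phi> \<in> borel_measurable borel"
  unfolding fourier_def by measurable

lemma norm_fourier_le: "norm (fourier \<phi> \<xi>) \<le> (LINT x|lborel. norm (\<phi> x))"
  unfolding fourier_def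
  using integral_norm_bound[of lborel "\<lambda>x. \<phi> x * cis (- (x * \<xi>))"]
  by (simp add: norm_mult)

text \<open>
  The integrability on the plane that Fubini needs in the multiplication formula.
\<close>

lemma integrable_lborel_kernel:
  fixes \<phi> k :: "real \<Rightarrow> complex"
  assumes \<phi>: "integrable lborel \<phi>" and k: "integrable lborel k"
  shows "integrable (lborel \<Otimes>\<^sub>M lborel) (\<lambda>(x, \<xi>). \<phi> x * cis (- (x * \<xi>)) * k \<xi>)"
proof (rule lborel_pair.Fubini_integrable)
  have [measurable]: "\<phi> \<in> borel_measurable borel" "k \<in> borel_measurable borel"
    using \<phi> k by auto
  show "(\<lambda>(x, \<xi>). \<phi> x * cis (- (x * \<xi>)) * k \<xi>) \<in> borel_measurable (lborel \<Otimes>\<^sub>M lborel)"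
    by measurable
  show "integrable lborel (\<lambda>x. LINT \<xi>|lborel. norm (case (x, \<xi>) of (x, \<xi>) \<Rightarrow> \<phi> x * cis (- (x * \<xi>)) * k \<xi>))"
    using \<phi> by (simp add: norm_mult)
  show "AE x in lborel. integrable lborel
      (\<lambda>\<xi>. case (x, \<xi>) of (x, \<xi>) \<Rightarrow> \<phi> x * cis (- (x * \<xi>)) * k \<xi>)"
  proof (rule AE_I2)
    fix x
    have "integrable lborel (\<lambda>\<xi>. \<phi> x * (k \<xi> * cis (- (x * \<xi>))))"
      by (intro integrable_mult_right integrable_mult_cis k) measurable
    then show "integrable lborel
        (\<lambda>\<xi>. case (x, \<xi>) of (x, \<xi>) \<Rightarrow> \<phi> x * cis (- (x * \<xi>)) * k \<xi>)"
      by (simp add: mult_ac)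
  qed
qed

lemma fourier_multiplication_formula:
  assumes \<phi>: "integrable lborel \<phi>" and k: "integrable lborel k"
  shows "(LINT \<xi>|lborel. fourier \<phi> \<xi> * k \<xi>) = (LINT x|lborel. \<phi> x * fourier k x)"
proof -
  have "(LINT \<xi>|lborel. fourier \<phi> \<xi> * k \<xi>)
      = (LINT \<xi>|lborel. LINT x|lborel. \<phi> x * cis (- (x * \<xi>)) * k \<xi>)"
    by (simp add: fourier_def)
  also have "\<dots> = (LINT x|lborel. LINT \<xi>|lborel. \<phi> x * cis (- (x * \<xi>)) * k \<xi>)"
    by (rule lborel_pair.Fubini_integral[OF integrable_lborel_kernel[OF \<phi> k]])
  also have "\<dots> = (LINT x|lborel. \<phi> x * fourier k x)"
  proof (rule Bochner_Integration.integral_cong[OF refl])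
    fix x
    have "(LINT \<xi>|lborel. \<phi> x * cis (- (x * \<xi>)) * k \<xi>)
        = (LINT \<xi>|lborel. \<phi> x * (k \<xi> * cis (- (\<xi> * x))))"
      by (simp add: mult_ac)
    then show "(LINT \<xi>|lborel. \<phi> x * cis (- (x * \<xi>)) * k \<xi>) = \<phi> x * fourier k x"
      by (simp add: fourier_def)
  qed
  finally show ?thesis .
qed

lemma fourier_std_normal:
  "(LINT x|lborel. of_real (std_normal_density x) * cis (s * x))
     = of_real (exp (- s\<^sup>2 / 2))"
proof -
  have "char std_normal_distribution s = (LINT x|lborel. of_real (std_normal_density x) * cis (s * x))"
    unfolding char_def
    by (subst integral_density) (auto simp: cis_conv_exp scaleR_conv_of_real)
  then show ?thesis by (simp add: char_std_normal_distribution)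
qed

lemma integrable_std_normal_density: "integrable lborel std_normal_density"
  using integrable_std_normal_moment[of 0] by simp

text \<open>
  A Gaussian of width \<open>1/e\<close>, modulated by \<open>x\<close>, transforms into \<open>sqrt (2 * pi)\<close> times a normal density
  of standard deviation \<open>e\<close> centred at \<open>- x\<close>; this is how the damping factor inserted in the Plancherel integral
  turns into a smoothing of \<open>\<phi>\<close>.
\<close>

lemma fourier_modulated_gaussian:
  assumes e: "e > 0"
  shows "fourier (\<lambda>\<xi>. of_real (std_normal_density (e * \<xi>)) * cis (- (x * \<xi>))) y
     = of_real (sqrt (2 * pi) / e * std_normal_density ((x + y) / e))"
proof -
  let ?F = "\<lambda>\<xi>. of_real (std_normal_density (e * \<xi>)) * cis (- ((x + y) * \<xi>))"
  have "fourier (\<lambda>\<xi>. of_real (std_normal_density (e * \<xi>)) * cis (- (x * \<xi>))) y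
      = (LINT \<xi>|lborel. ?F \<xi>)"
    unfolding fourier_def by (simp only: mult.assoc cis_mult) (simp add: algebra_simps)
  also have "\<dots> = (1 / e) *\<^sub>R (LINT w|lborel. of_real (std_normal_density w) * cis (- ((x + y) / e) * w))"
    using e by (subst lborel_integral_real_affine[where c = "1 / e" and t = 0])
      (auto simp: field_simps)
  also have "\<dots> = of_real (1 / e * exp (- ((x + y) / e)\<^sup>2 / 2))"
    by (subst fourier_std_normal) (simp add: scaleR_conv_of_real)
  finally show ?thesis
    by (simp add: std_normal_density_def)
qed

lemma integrable_shift_gaussian:
  fixes \<phi> :: "real \<Rightarrow> complex"
  assumes [measurable]: "\<phi> \<in> borel_measurable borel" and b: "\<And>x. norm (\<phi> x) \<le> B"
  shows "integrable lborel (\<lambda>w. of_real (std_normal_density w) * \<phi> (x - e * w))"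
  by (rule integrable_bounded_mult[where B = B]) (use integrable_std_normal_density b in auto)

text \<open>
  Damped by a Gaussian, the Plancherel integral is absolutely convergent and can be computed. Writing
  \<open>|F\<phi>|\<^sup>2 = F\<phi> \<cdot> F\<psi>\<close> with \<open>\<psi>(y) = cnj (\<phi>(-y))\<close>, the multiplication formula moves first one and then
  the other transform onto the Gaussian, which becomes a kernel of width \<open>e\<close>.
\<close>

lemma fourier_gaussian_regularised:
  assumes \<phi>: "integrable lborel \<phi>" and b: "\<And>x. norm (\<phi> x) \<le> B" and e: "e > 0"
  shows "integrable lborel (\<lambda>\<xi>. std_normal_density (e * \<xi>) * (norm (fourier \<phi> \<xi>))\<^sup>2)"
    and "of_real (LINT \<xi>|lborel. std_normal_density (e * \<xi>) * (norm (fourier \<phi> \<xi>))\<^sup>2) =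
     of_real (sqrt (2 * pi)) * (LINT x|lborel. \<phi> x *
        (LINT w|lborel. of_real (std_normal_density w) * cnj (\<phi> (x - e * w))))"
proof -
  have m [measurable]: "\<phi> \<in> borel_measurable borel" using \<phi> by auto
  define \<psi> where "\<psi> y = cnj (\<phi> (- y))" for y
  have \<psi>: "integrable lborel \<psi>"
    using lborel_integrable_real_affine[OF integrable_cnj[OF \<phi>], of "-1" 0] unfolding \<psi>_def by simp
  have f\<psi>: "fourier \<psi> \<xi> = cnj (fourier \<phi> \<xi>)" for \<xi>
  proof -
    have "fourier \<psi> \<xi> = (LINT y|lborel. cnj (\<phi> (- y)) * cis (- (y * \<xi>)))"
      by (simp add: fourier_def \<psi>_def)
    also have "\<dots> = (LINT y|lborel. cnj (\<phi> y) * cis (y * \<xi>))"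
      by (subst lborel_integral_real_affine[where c = "-1" and t = 0]) auto
    also have "\<dots> = (LINT y|lborel. cnj (\<phi> y * cis (- (y * \<xi>))))"
      by (simp add: cis_cnj)
    also have "\<dots> = cnj (fourier \<phi> \<xi>)"
      unfolding fourier_def by (rule Bochner_Integration.integral_cnj)
    finally show ?thesis .
  qed
  have n: "integrable lborel (\<lambda>\<xi>. complex_of_real (std_normal_density (e * \<xi>)))"
    using lborel_integrable_real_affine[OF integrable_std_normal_density, of e 0] e
    by simp
  have k: "integrable lborel (\<lambda>\<xi>. of_real (std_normal_density (e * \<xi>)) * fourier \<psi> \<xi>)"
    by (rule integrable_bounded_mult[OF n _ norm_fourier_le]) (use \<psi> in measurable)
  \<comment> \<open>The damped spectral density, as a product to which the multiplication formula applies.\<close>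
  have sq: "fourier \<phi> \<xi> * (of_real (std_normal_density (e * \<xi>)) * fourier \<psi> \<xi>)
      = of_real (std_normal_density (e * \<xi>) * (norm (fourier \<phi> \<xi>))\<^sup>2)" for \<xi>
    by (simp add: f\<psi> complex_norm_square mult_ac del: of_real_power)
  have "integrable lborel (\<lambda>\<xi>. (of_real (std_normal_density (e * \<xi>)) * fourier \<psi> \<xi>) * fourier \<phi> \<xi>)"
    by (rule integrable_bounded_mult[OF k _ norm_fourier_le]) measurable
  then have "integrable lborel (\<lambda>\<xi>. complex_of_real (std_normal_density (e * \<xi>) * (norm (fourier \<phi> \<xi>))\<^sup>2))"
    by (subst sq[symmetric]) (simp add: mult_ac)
  then show "integrable lborel (\<lambda>\<xi>. std_normal_density (e * \<xi>) * (norm (fourier \<phi> \<xi>))\<^sup>2)"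
    by (simp only: complex_of_real_integrable_eq)
  \<comment> \<open>The second use of the multiplication formula, followed by the substitution \<open>y = - x + e * w\<close>.\<close>
  have inner: "fourier (\<lambda>\<xi>. of_real (std_normal_density (e * \<xi>)) * fourier \<psi> \<xi>) x
      = of_real (sqrt (2 * pi)) * (LINT w|lborel. of_real (std_normal_density w) * cnj (\<phi> (x - e * w)))" for x
  proof -
    have kx: "integrable lborel (\<lambda>\<xi>. of_real (std_normal_density (e * \<xi>)) * cis (- (x * \<xi>)))"
      by (intro integrable_mult_cis n) measurable
    have "fourier (\<lambda>\<xi>. of_real (std_normal_density (e * \<xi>)) * fourier \<psi> \<xi>) x
        = (LINT \<xi>|lborel. fourier \<psi> \<xi> * (of_real (std_normal_density (e * \<xi>)) * cis (- (x * \<xi>))))"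
      unfolding fourier_def[of "\<lambda>\<xi>. of_real (std_normal_density (e * \<xi>)) * fourier \<psi> \<xi>"]
      by (simp add: mult_ac)
    also have "\<dots> = (LINT y|lborel. \<psi> y * of_real (sqrt (2 * pi) / e * std_normal_density ((x + y) / e)))"
      by (subst fourier_multiplication_formula[OF \<psi> kx]) (simp only: fourier_modulated_gaussian[OF e])
    also have "\<dots> = e *\<^sub>R (LINT w|lborel. \<psi> (- x + e * w) *
        of_real (sqrt (2 * pi) / e * std_normal_density w))"
      using e by (subst lborel_integral_real_affine[where c = e and t = "- x"]) auto
    also have "\<dots> = e *\<^sub>R (LINT w|lborel. of_real (sqrt (2 * pi) / e) *
        (of_real (std_normal_density w) * cnj (\<phi> (x - e * w))))"
      by (simp add: \<psi>_def mult_ac)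
    also have "\<dots> = of_real (sqrt (2 * pi)) * (LINT w|lborel. of_real (std_normal_density w) * cnj (\<phi> (x - e * w)))"
      using e by (simp add: scaleR_conv_of_real)
    finally show ?thesis .
  qed
  have "of_real (LINT \<xi>|lborel. std_normal_density (e * \<xi>) * (norm (fourier \<phi> \<xi>))\<^sup>2)
     = (LINT \<xi>|lborel. fourier \<phi> \<xi> * (of_real (std_normal_density (e * \<xi>)) * fourier \<psi> \<xi>))"
    by (simp only: sq integral_complex_of_real)
  also have "\<dots> = (LINT x|lborel. \<phi> x * (of_real (sqrt (2 * pi)) *
      (LINT w|lborel. of_real (std_normal_density w) * cnj (\<phi> (x - e * w)))))"
    by (subst fourier_multiplication_formula[OF \<phi> k]) (simp only: inner)
  also have "\<dots> = of_real (sqrt (2 * pi)) * (LINT x|lborel. \<phi> x *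
        (LINT w|lborel. of_real (std_normal_density w) * cnj (\<phi> (x - e * w))))"
    by (subst integral_mult_right_zero[symmetric]) (simp only: mult_ac)
  finally show "of_real (LINT \<xi>|lborel. std_normal_density (e * \<xi>) * (norm (fourier \<phi> \<xi>))\<^sup>2) =
     of_real (sqrt (2 * pi)) * (LINT x|lborel. \<phi> x *
        (LINT w|lborel. of_real (std_normal_density w) * cnj (\<phi> (x - e * w))))" .
qed

text \<open>
  As \<open>e\<close> decreases to 0, the smoothed values of \<open>cnj \<phi>\<close> converge to \<open>cnj \<phi>\<close> because \<open>\<phi>\<close> is continuous
  and bounded, while the damping factor increases to the constant \<open>1 / sqrt (2 * pi)\<close>. Monotone
  convergence on the damped side gives the square integrability of the transform as a conclusion,
  so that no decay of it has to be established: this is why one continuous derivative of the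
  spectrum suffices for the second moments below.
\<close>

lemma plancherel:
  fixes \<phi> :: "real \<Rightarrow> complex"
  assumes \<phi>: "integrable lborel \<phi>" and cont: "continuous_on UNIV \<phi>" and b: "\<And>x. norm (\<phi> x) \<le> B"
  shows "has_bochner_integral lborel (\<lambda>\<xi>. (norm (fourier \<phi> \<xi>))\<^sup>2)
    (2 * pi * (LINT x|lborel. (norm (\<phi> x))\<^sup>2))"
proof -
  define e where "e n = inverse (real (Suc n))" for n
  have e: "e n > 0" for n by (simp add: e_def)
  have e0: "e \<longlonglongrightarrow> 0" unfolding e_def by (rule LIMSEQ_inverse_real_of_nat)
  have m [measurable]: "\<phi> \<in> borel_measurable borel" using \<phi> by auto
  let ?n = std_normal_density
  let ?I = "\<lambda>n x. LINT w|lborel. of_real (?n w) * cnj (\<phi> (x - e n * w))"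
  have In: "integrable lborel (\<lambda>w. of_real (?n w) * cnj (\<phi> (x - e n * w)))" for x n
    using integrable_shift_gaussian[of "\<lambda>x. cnj (\<phi> x)" B x "e n"] b by simp
  have I: "(\<lambda>n. ?I n x) \<longlonglongrightarrow> cnj (\<phi> x)" for x
  proof -
    have "(\<lambda>n. ?I n x) \<longlonglongrightarrow> (LINT w|lborel. of_real (?n w) * cnj (\<phi> x))"
    proof (rule integral_dominated_convergence)
      show "integrable lborel (\<lambda>w. ?n w * B)" using integrable_std_normal_density by simp
      show "AE w in lborel. (\<lambda>n. of_real (?n w) * cnj (\<phi> (x - e n * w))) \<longlonglongrightarrow> of_real (?n w) * cnj (\<phi> x)"
      proof (rule AE_I2)
        fix w
        have "(\<lambda>n. x - e n * w) \<longlonglongrightarrow> x - 0 * w" by (intro tendsto_intros e0)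
        then have "(\<lambda>n. \<phi> (x - e n * w)) \<longlonglongrightarrow> \<phi> x"
          using continuous_on_tendsto_compose[OF cont, of "\<lambda>n. x - e n * w"] by simp
        then show "(\<lambda>n. of_real (?n w) * cnj (\<phi> (x - e n * w))) \<longlonglongrightarrow> of_real (?n w) * cnj (\<phi> x)"
          by (intro tendsto_intros)
      qed
      show "AE w in lborel. norm (of_real (?n w) * cnj (\<phi> (x - e n * w))) \<le> ?n w * B" for n
        using b by (auto simp: norm_mult intro!: mult_left_mono)
    qed measurable
    moreover have "(LINT w|lborel. ?n w) = 1"
      using integral_std_normal_moment_even[of 0] by simp
    ultimately show ?thesis by (simp add: integral_complex_of_real)
  qed
  have bI: "norm (?I n x) \<le> B" for n x
  proof -
    have "norm (?I n x) \<le> (LINT w|lborel. ?n w * B)"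
    proof (rule order_trans[OF integral_norm_bound integral_mono])
      show "integrable lborel (\<lambda>w. norm (of_real (?n w) * cnj (\<phi> (x - e n * w))))"
        by (rule integrable_norm[OF In])
      show "integrable lborel (\<lambda>w. ?n w * B)" using integrable_std_normal_density by simp
      show "norm (of_real (?n w) * cnj (\<phi> (x - e n * w))) \<le> ?n w * B" for w
        using b by (auto simp: norm_mult intro!: mult_left_mono)
    qed
    also have "\<dots> = B" using integral_std_normal_moment_even[of 0] by simp
    finally show ?thesis .
  qed
  have lim: "(\<lambda>n. LINT x|lborel. \<phi> x * ?I n x) \<longlonglongrightarrow> (LINT x|lborel. \<phi> x * cnj (\<phi> x))"
  proof (rule integral_dominated_convergence)
    show "integrable lborel (\<lambda>x. norm (\<phi> x) * B)" using \<phi> by simp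
    show "AE x in lborel. (\<lambda>n. \<phi> x * ?I n x) \<longlonglongrightarrow> \<phi> x * cnj (\<phi> x)"
      by (intro AE_I2 tendsto_intros I)
    show "AE x in lborel. norm (\<phi> x * ?I n x) \<le> norm (\<phi> x) * B" for n
      using bI by (auto simp: norm_mult intro!: mult_left_mono)
  qed measurable
  have sq: "(LINT x|lborel. \<phi> x * cnj (\<phi> x)) = of_real (LINT x|lborel. (norm (\<phi> x))\<^sup>2)"
    by (simp only: complex_norm_square[symmetric] integral_complex_of_real)
  have reg: "(\<lambda>n. LINT \<xi>|lborel. ?n (e n * \<xi>) * (norm (fourier \<phi> \<xi>))\<^sup>2)
      \<longlonglongrightarrow> sqrt (2 * pi) * (LINT x|lborel. (norm (\<phi> x))\<^sup>2)"
  proof -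
    have "(\<lambda>n. complex_of_real (LINT \<xi>|lborel. ?n (e n * \<xi>) * (norm (fourier \<phi> \<xi>))\<^sup>2))
      \<longlonglongrightarrow> of_real (sqrt (2 * pi)) * of_real (LINT x|lborel. (norm (\<phi> x))\<^sup>2)"
      unfolding fourier_gaussian_regularised(2)[OF \<phi> b e] sq[symmetric]
      by (intro tendsto_intros lim)
    then show ?thesis
      by (simp only: of_real_mult[symmetric] tendsto_of_real_iff)
  qed
  have "has_bochner_integral lborel (\<lambda>\<xi>. ?n 0 * (norm (fourier \<phi> \<xi>))\<^sup>2)
      (sqrt (2 * pi) * (LINT x|lborel. (norm (\<phi> x))\<^sup>2))"
  proof (rule has_bochner_integral_monotone_convergence[OF _ _ _ reg])
    show "integrable lborel (\<lambda>\<xi>. ?n (e n * \<xi>) * (norm (fourier \<phi> \<xi>))\<^sup>2)" for n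
      by (rule fourier_gaussian_regularised(1)[OF \<phi> b e])
    have "?n (e i * \<xi>) \<le> ?n (e j * \<xi>)" if "i \<le> j" for i j \<xi>
    proof -
      have "e j \<le> e i" using that by (simp add: e_def)
      then have "(e j * \<xi>)\<^sup>2 \<le> (e i * \<xi>)\<^sup>2"
        using e[of j] unfolding power_mult_distrib by (intro mult_right_mono power_mono) auto
      then show ?thesis by (simp add: std_normal_density_def divide_right_mono)
    qed
    then show "AE \<xi> in lborel. mono (\<lambda>n. ?n (e n * \<xi>) * (norm (fourier \<phi> \<xi>))\<^sup>2)"
      by (auto intro!: monoI mult_right_mono)
    show "AE \<xi> in lborel. (\<lambda>n. ?n (e n * \<xi>) * (norm (fourier \<phi> \<xi>))\<^sup>2) \<longlonglongrightarrow> ?n 0 * (norm (fourier \<phi> \<xi>))\<^sup>2"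
    proof (rule AE_I2)
      fix \<xi>
      have "(\<lambda>n. 1 / sqrt (2 * pi) * exp (- (e n * \<xi>)\<^sup>2 / 2) * (norm (fourier \<phi> \<xi>))\<^sup>2)
          \<longlonglongrightarrow> 1 / sqrt (2 * pi) * exp (- (0 * \<xi>)\<^sup>2 / 2) * (norm (fourier \<phi> \<xi>))\<^sup>2"
        by (intro tendsto_intros e0) auto
      then show "(\<lambda>n. ?n (e n * \<xi>) * (norm (fourier \<phi> \<xi>))\<^sup>2) \<longlonglongrightarrow> ?n 0 * (norm (fourier \<phi> \<xi>))\<^sup>2"
        by (simp add: std_normal_density_def)
    qed
  qed measurable
  from has_bochner_integral_mult_right[of "sqrt (2 * pi)", OF this]
  show ?thesis by (simp add: std_normal_density_def mult.assoc[symmetric])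
qed

section \<open>Smoothness of the spectrum of a Schwartz function\<close>

lemma schwartz_weighted_bounded:
  assumes "schwartz u"
  obtains B where "\<And>x. norm (x ^ k *\<^sub>R u x) \<le> B"
proof -
  have "bounded (range (\<lambda>x. x ^ k *\<^sub>R nth_vderiv 0 u x))"
    using assms unfolding schwartz_def by blast
  then obtain B where "\<And>x. norm (x ^ k *\<^sub>R u x) \<le> B"
    by (auto simp: bounded_iff nth_vderiv_def)
  then show ?thesis by (rule that)
qed

lemma schwartz_continuous:
  assumes "schwartz u"
  shows "continuous_on UNIV u"
proof -
  have "nth_vderiv 0 u differentiable (at x)" for x
    using assms unfolding schwartz_def by blast
  then show ?thesis
    by (auto simp: nth_vderiv_def intro!: continuous_at_imp_continuous_on
        differentiable_imp_continuous_within)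
qed

lemma integrable_inverse_one_plus_square: "integrable lborel (\<lambda>x::real. inverse (1 + x\<^sup>2))"
  using integrable_inverse_1_plus_square by (simp add: set_integrable_def einterval_def)

text \<open>
  Two more powers of \<open>x\<close> than \<open>k\<close> make \<open>x\<^sup>k u\<close> decay like \<open>1 / (1 + x\<^sup>2)\<close>.
\<close>

lemma schwartz_weighted_integrable:
  assumes "schwartz u"
  shows "integrable lborel (\<lambda>x. x ^ k *\<^sub>R u x)"
proof -
  obtain A where A: "\<And>x. norm (x ^ k *\<^sub>R u x) \<le> A"
    using schwartz_weighted_bounded[OF assms, of k] by blast
  obtain B where B: "\<And>x. norm (x ^ (k + 2) *\<^sub>R u x) \<le> B"
    using schwartz_weighted_bounded[OF assms, of "k + 2"] by blast
  show ?thesis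
  proof (rule Bochner_Integration.integrable_bound)
    show "integrable lborel (\<lambda>x::real. (A + B) * inverse (1 + x\<^sup>2))"
      using integrable_inverse_one_plus_square by simp
    show "(\<lambda>x. x ^ k *\<^sub>R u x) \<in> borel_measurable lborel"
      using schwartz_continuous[OF assms]
      by (auto intro!: borel_measurable_continuous_onI continuous_intros)
    show "AE x in lborel. norm (x ^ k *\<^sub>R u x) \<le> norm ((A + B) * inverse (1 + x\<^sup>2))"
    proof (rule AE_I2)
      fix x :: real
      have pos: "0 < 1 + x\<^sup>2" by (smt (verit) zero_le_power2)
      have "norm (x ^ k *\<^sub>R u x) * (1 + x\<^sup>2)
          = norm (x ^ k *\<^sub>R u x) + norm (x ^ (k + 2) *\<^sub>R u x)"
        by (simp add: power_add abs_mult algebra_simps power2_eq_square)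
      also have "\<dots> \<le> A + B" using A[of x] B[of x] by simp
      finally have "norm (x ^ k *\<^sub>R u x) \<le> (A + B) * inverse (1 + x\<^sup>2)"
        using pos by (simp add: field_simps)
      then show "norm (x ^ k *\<^sub>R u x) \<le> norm ((A + B) * inverse (1 + x\<^sup>2))"
        by simp
    qed
  qed
qed

lemma norm_cis_diff_le: "norm (cis a - cis b) \<le> \<bar>a - b\<bar>"
proof -
  have "cis a - cis b = cis b * (cis (a - b) - 1)"
    by (simp add: algebra_simps cis_mult)
  then have "norm (cis a - cis b) = norm (cis (a - b) - 1)" by (simp add: norm_mult)
  also have "\<dots> \<le> \<bar>a - b\<bar>" using iexp_approx1[of "a - b" 0] by (simp add: cis_conv_exp)
  finally show ?thesis .
qed

lemma has_vector_derivative_iff_quotient: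
  fixes f :: "real \<Rightarrow> 'a :: real_normed_vector"
  shows "(f has_vector_derivative D) (at p) \<longleftrightarrow> ((\<lambda>q. (f q - f p) /\<^sub>R (q - p)) \<longlongrightarrow> D) (at p)"
proof -
  have "norm ((f q - f p - (q - p) *\<^sub>R D) /\<^sub>R norm (q - p)) = norm ((f q - f p) /\<^sub>R (q - p) - D)"
    if "q \<noteq> p" for q
  proof -
    have "(f q - f p) /\<^sub>R (q - p) - D = (f q - f p - (q - p) *\<^sub>R D) /\<^sub>R (q - p)"
      using that by (simp add: scaleR_diff_right)
    then show ?thesis by simp
  qed
  then have "((\<lambda>q. norm ((f q - f p - (q - p) *\<^sub>R D) /\<^sub>R norm (q - p))) \<longlongrightarrow> 0) (at p) \<longleftrightarrow>
      ((\<lambda>q. norm ((f q - f p) /\<^sub>R (q - p) - D)) \<longlongrightarrow> 0) (at p)"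
    by (intro tendsto_cong) (auto simp: eventually_at_filter)
  then show ?thesis
    unfolding has_vector_derivative_def has_derivative_at_within tendsto_norm_zero_iff
    by (auto simp: bounded_linear_scaleR_left LIM_zero_iff)
qed

text \<open>
  Differentiation under the integral sign: \<open>\<bar>x \<phi> x\<bar>\<close> dominates all difference quotients, since
  \<open>q \<mapsto> cis (- x q)\<close> is Lipschitz with constant \<open>\<bar>x\<bar>\<close>.
\<close>

lemma fourier_has_vector_derivative:
  assumes \<phi>: "integrable lborel \<phi>" and x\<phi>: "integrable lborel (\<lambda>x. x *\<^sub>R \<phi> x)"
  shows "(fourier \<phi> has_vector_derivative fourier (\<lambda>x. - (\<i> * (x *\<^sub>R \<phi> x))) p) (at p)"
proof -
  have [measurable]: "\<phi> \<in> borel_measurable borel" using \<phi> by auto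
  let ?Q = "\<lambda>q x. \<phi> x * ((cis (- (x * q)) - cis (- (x * p))) /\<^sub>R (q - p))"
  let ?D = "\<lambda>x. - (\<i> * (x *\<^sub>R \<phi> x)) * cis (- (x * p))"
  have Q: "(fourier \<phi> q - fourier \<phi> p) /\<^sub>R (q - p) = (LINT x|lborel. ?Q q x)" for q
  proof -
    have "fourier \<phi> q - fourier \<phi> p = (LINT x|lborel. \<phi> x * (cis (- (x * q)) - cis (- (x * p))))"
      unfolding fourier_def
      by (subst Bochner_Integration.integral_diff[symmetric])
        (auto simp: algebra_simps intro!: integrable_mult_cis[OF \<phi>])
    then show ?thesis
      by (simp flip: integral_scaleR_right)
  qed
  have "((\<lambda>q. LINT x|lborel. ?Q q x) \<longlongrightarrow> (LINT x|lborel. ?D x)) (at p)"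
    unfolding tendsto_at_iff_sequentially
  proof (intro allI impI)
    fix X :: "nat \<Rightarrow> real"
    assume X: "\<forall>i. X i \<in> UNIV - {p}" "X \<longlonglongrightarrow> p"
    have "(\<lambda>n. LINT x|lborel. ?Q (X n) x) \<longlonglongrightarrow> (LINT x|lborel. ?D x)"
    proof (rule integral_dominated_convergence)
      show "integrable lborel (\<lambda>x. norm (x *\<^sub>R \<phi> x))" using x\<phi> by (rule integrable_norm)
      show "AE x in lborel. (\<lambda>n. ?Q (X n) x) \<longlonglongrightarrow> ?D x"
      proof (rule AE_I2)
        fix x
        have "((\<lambda>q. cis (- (x * q))) has_vector_derivative of_real (- x) * (\<i> * cis (- (x * p)))) (at p)"
          by (auto intro!: derivative_eq_intros)
        then have "((\<lambda>q. (cis (- (x * q)) - cis (- (x * p))) /\<^sub>R (q - p)) \<longlongrightarrow>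
            of_real (- x) * (\<i> * cis (- (x * p)))) (at p)"
          by (simp add: has_vector_derivative_iff_quotient)
        then have "(\<lambda>n. (cis (- (x * X n)) - cis (- (x * p))) /\<^sub>R (X n - p)) \<longlonglongrightarrow>
            of_real (- x) * (\<i> * cis (- (x * p)))"
          using X unfolding tendsto_at_iff_sequentially by (auto simp: o_def)
        then have "(\<lambda>n. ?Q (X n) x) \<longlonglongrightarrow> \<phi> x * (of_real (- x) * (\<i> * cis (- (x * p))))"
          by (intro tendsto_intros)
        then show "(\<lambda>n. ?Q (X n) x) \<longlonglongrightarrow> ?D x"
          by (simp add: scaleR_conv_of_real mult_ac)
      qed
      show "AE x in lborel. norm (?Q (X n) x) \<le> norm (x *\<^sub>R \<phi> x)" for n
      proof (rule AE_I2)
        fix x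
        have "norm (cis (- (x * X n)) - cis (- (x * p))) \<le> \<bar>x\<bar> * \<bar>X n - p\<bar>"
          using norm_cis_diff_le[of "- (x * X n)" "- (x * p)"]
          by (simp add: abs_mult[symmetric] algebra_simps abs_minus_commute)
        then have "norm ((cis (- (x * X n)) - cis (- (x * p))) /\<^sub>R (X n - p)) \<le> \<bar>x\<bar>"
          using X(1)[rule_format, of n] unfolding norm_scaleR
          by (simp add: divide_inverse_commute[symmetric] pos_divide_le_eq)
        then have "norm (\<phi> x) * norm ((cis (- (x * X n)) - cis (- (x * p))) /\<^sub>R (X n - p))
            \<le> norm (\<phi> x) * \<bar>x\<bar>"
          by (rule mult_left_mono) simp
        then show "norm (?Q (X n) x) \<le> norm (x *\<^sub>R \<phi> x)"
          unfolding norm_mult norm_scaleR[of x] by (simp only: mult.commute)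
      qed
    qed measurable
    then show "((\<lambda>q. LINT x|lborel. ?Q q x) \<circ> X) \<longlonglongrightarrow> (LINT x|lborel. ?D x)"
      by (simp add: o_def)
  qed
  then show ?thesis
    unfolding has_vector_derivative_iff_quotient Q
    unfolding fourier_def[of "\<lambda>x. - (\<i> * (x *\<^sub>R \<phi> x))"] .
qed

lemma schwartz_fourier_C1:
  assumes u: "schwartz u"
  obtains g' where "\<And>p. (fourier u has_vector_derivative g' p) (at p)" "continuous_on UNIV g'"
proof -
  let ?v = "\<lambda>x. - (\<i> * (x *\<^sub>R u x))"
  have i: "integrable lborel u" "integrable lborel (\<lambda>x. x *\<^sub>R u x)"
      "integrable lborel (\<lambda>x. x\<^sup>2 *\<^sub>R u x)"
    using schwartz_weighted_integrable[OF u, of 0] schwartz_weighted_integrable[OF u, of 1]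
      schwartz_weighted_integrable[OF u, of 2] by simp_all
  have v: "integrable lborel ?v"
    using integrable_mult_right[of "- \<i>", OF i(2)] by simp
  have "x *\<^sub>R ?v x = - \<i> * (x\<^sup>2 *\<^sub>R u x)" for x by (simp add: power2_eq_square)
  then have xv: "integrable lborel (\<lambda>x. x *\<^sub>R ?v x)"
    using integrable_mult_right[of "- \<i>", OF i(3)] by (simp only:)
  have "continuous_on UNIV (fourier ?v)"
    by (intro continuous_at_imp_continuous_on ballI
        has_vector_derivative_continuous[OF fourier_has_vector_derivative[OF v xv]])
  with fourier_has_vector_derivative[OF i(1,2)] show ?thesis by (rule that)
qed

section \<open>Compactly supported spectra and moments in space\<close>

lemma compact_support_integrable:
  fixes h :: "real \<Rightarrow> 'a :: {banach, second_countable_topology}"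
  assumes "continuous_on UNIV h" and "\<And>x. x \<notin> {a..b} \<Longrightarrow> h x = 0"
  shows "integrable lborel h"
proof -
  have "integrable lborel (\<lambda>x. indicator {a..b} x *\<^sub>R h x)"
    using assms(1) by (intro borel_integrable_compact) (auto intro: continuous_on_subset)
  also have "(\<lambda>x. indicator {a..b} x *\<^sub>R h x) = h"
    using assms(2) by (auto simp: indicator_def)
  finally show ?thesis .
qed

lemma compact_support_bounded:
  fixes h :: "real \<Rightarrow> 'a :: real_normed_vector"
  assumes "continuous_on UNIV h" and "\<And>x. x \<notin> {a..b} \<Longrightarrow> h x = 0"
  obtains B where "\<And>x. norm (h x) \<le> B"
proof -
  have "compact (h ` {a..b})"
    using assms(1) by (intro compact_continuous_image) (auto intro: continuous_on_subset)
  then have "bounded (h ` {a..b})" by (rule compact_imp_bounded)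
  then obtain B where "\<forall>y \<in> h ` {a..b}. norm y \<le> B"
    unfolding bounded_iff ..
  then have B: "norm (h x) \<le> B" if "x \<in> {a..b}" for x
    using that by blast
  have "norm (h x) \<le> max B 0" for x
    using B[of x] assms(2)[of x] by (cases "x \<in> {a..b}") auto
  then show ?thesis by (rule that)
qed

lemma vector_derivative_zero_off_support:
  fixes h :: "real \<Rightarrow> 'a :: real_normed_vector"
  assumes d: "(h has_vector_derivative h') (at x)" and z: "\<And>x. x \<notin> {a..b} \<Longrightarrow> h x = 0"
    and x: "x \<notin> {a..b}"
  shows "h' = 0"
proof -
  have "(h has_vector_derivative 0) (at x)"
    by (rule has_vector_derivative_transform_within_open[OF has_vector_derivative_const, of "- {a..b}"])
      (use x z in auto)
  with d show ?thesis by (rule vector_derivative_unique_at)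
qed

text \<open>
  Integration by parts, in the form that the derivative of \<open>G x * cis (- (x * \<xi>))\<close> has integral 0.
\<close>

lemma fourier_derivative:
  assumes d: "\<And>x. (G has_vector_derivative G' x) (at x)" and c: "continuous_on UNIV G'"
    and z: "\<And>x. x \<notin> {a..b} \<Longrightarrow> G x = 0"
  shows "fourier G' \<xi> = \<i> * of_real \<xi> * fourier G \<xi>"
proof -
  have cG: "continuous_on UNIV G"
    by (intro continuous_at_imp_continuous_on ballI has_vector_derivative_continuous[OF d])
  have z': "G' x = 0" if "x \<notin> {a..b}" for x
    by (rule vector_derivative_zero_off_support[OF d z that])
  have i: "integrable lborel G" "integrable lborel G'"
    using compact_support_integrable[OF cG z] compact_support_integrable[OF c z'] by auto
  let ?D = "\<lambda>x. G' x * cis (- (x * \<xi>)) - \<i> * of_real \<xi> * (G x * cis (- (x * \<xi>)))"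
  \<comment> \<open>The margins make \<open>G\<close> vanish at both end points, also when \<open>b < a\<close>.\<close>
  let ?l = "a - 1" and ?r = "max a b + 1"
  have "(LINT x|lborel. indicator {?l..?r} x *\<^sub>R ?D x)
      = G ?r * cis (- (?r * \<xi>)) - G ?l * cis (- (?l * \<xi>))"
  proof (rule integral_FTC_atLeastAtMost)
    fix x
    show "((\<lambda>x. G x * cis (- (x * \<xi>))) has_vector_derivative ?D x) (at x within {?l..?r})"
      by (auto intro!: derivative_eq_intros has_vector_derivative_at_within[OF d] simp: algebra_simps)
  next
    show "continuous_on {?l..?r} ?D"
      by (intro continuous_intros continuous_on_subset[OF c] continuous_on_subset[OF cG]) auto
  qed simp
  also have "\<dots> = 0" using z[of ?l] z[of ?r] by (simp add: max_def split: if_splits)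
  also have "(\<lambda>x. indicator {?l..?r} x *\<^sub>R ?D x) = ?D"
  proof
    fix x show "indicator {?l..?r} x *\<^sub>R ?D x = ?D x"
      using z[of x] z'[of x] by (cases "x \<in> {a..b}") (auto simp: indicator_def)
  qed
  also have "(LINT x|lborel. ?D x) = fourier G' \<xi> - \<i> * of_real \<xi> * fourier G \<xi>"
    unfolding fourier_def using i
    by (subst Bochner_Integration.integral_diff) (auto intro!: integrable_mult_cis integrable_mult_right)
  finally show ?thesis by simp
qed

text \<open>
  Shifting the origin by \<open>r\<close> lets one identity serve both moments: \<open>r = 0\<close> is the second moment of
  \<open>|FG|\<^sup>2\<close>, and comparing \<open>r = 0\<close> with another value of \<open>r\<close> isolates the first.
\<close>

lemma plancherel_weighted:
  assumes d: "\<And>x. (G has_vector_derivative G' x) (at x)" and c: "continuous_on UNIV G'"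
    and z: "\<And>x. x \<notin> {a..b} \<Longrightarrow> G x = 0"
  shows "has_bochner_integral lborel (\<lambda>\<xi>. (\<xi> + r)\<^sup>2 * (norm (fourier G \<xi>))\<^sup>2)
    (2 * pi * (LINT x|lborel. (norm (G' x + \<i> * of_real r * G x))\<^sup>2))"
proof -
  have cG: "continuous_on UNIV G"
    by (intro continuous_at_imp_continuous_on ballI has_vector_derivative_continuous[OF d])
  have z': "G' x = 0" if "x \<notin> {a..b}" for x
    by (rule vector_derivative_zero_off_support[OF d z that])
  let ?\<phi> = "\<lambda>x. G' x + \<i> * of_real r * G x"
  have c\<phi>: "continuous_on UNIV ?\<phi>" by (intro continuous_intros c cG)
  have z\<phi>: "?\<phi> x = 0" if "x \<notin> {a..b}" for x using z z' that by simp
  obtain B where B: "\<And>x. norm (?\<phi> x) \<le> B" using compact_support_bounded[OF c\<phi> z\<phi>] by blast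
  have i: "integrable lborel G" "integrable lborel G'"
    using compact_support_integrable[OF cG z] compact_support_integrable[OF c z'] by auto
  have f: "fourier ?\<phi> \<xi> = \<i> * of_real (\<xi> + r) * fourier G \<xi>" for \<xi>
  proof -
    have "fourier ?\<phi> \<xi> = (LINT x|lborel. G' x * cis (- (x * \<xi>)) + \<i> * of_real r * (G x * cis (- (x * \<xi>))))"
      unfolding fourier_def by (simp add: algebra_simps)
    also have "\<dots> = fourier G' \<xi> + \<i> * of_real r * fourier G \<xi>"
      unfolding fourier_def using i
      by (subst Bochner_Integration.integral_add) (auto intro!: integrable_mult_cis integrable_mult_right)
    finally show ?thesis
      by (simp only: fourier_derivative[OF d c z]) (simp add: algebra_simps)
  qed
  have "(norm (fourier ?\<phi> \<xi>))\<^sup>2 = (\<xi> + r)\<^sup>2 * (norm (fourier G \<xi>))\<^sup>2" for \<xi>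
    unfolding f by (simp only: norm_mult norm_ii norm_of_real power_mult_distrib power2_abs) simp
  with plancherel[OF compact_support_integrable[OF c\<phi> z\<phi>] c\<phi> B] show ?thesis by simp
qed

section \<open>Averages over the spectrum\<close>

text \<open>
  What the moment computations use of the symbol and of the initial state: a \<open>C\<^sup>2\<close> strictly convex
  symbol, and a \<open>C\<^sup>1\<close> spectrum supported in \<open>[a, b]\<close> whose density \<open>|g|\<^sup>2 / (2 * pi)\<close> is a probability
  density.
\<close>

locale wave_packet_spectrum =
  fixes f :: "real \<Rightarrow> real" and u0 g' :: "real \<Rightarrow> complex" and a b :: real
  assumes f_deriv: "\<And>p. (f has_real_derivative deriv f p) (at p)"
    and f_deriv2: "\<And>p. (deriv f has_real_derivative deriv (deriv f) p) (at p)"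
    and f_deriv2_continuous: "continuous_on UNIV (deriv (deriv f))"
    and f_convex: "\<And>p. deriv (deriv f) p > 0"
    and ab: "a \<le> b"
    and spectrum_deriv: "\<And>p. (fourier u0 has_vector_derivative g' p) (at p)"
    and spectrum_deriv_continuous: "continuous_on UNIV g'"
    and spectrum_support: "\<And>p. p \<notin> {a..b} \<Longrightarrow> fourier u0 p = 0"
    and spectrum_mass: "(LINT p|lborel. (norm (fourier u0 p))\<^sup>2) = 2 * pi"
begin

abbreviation "g \<equiv> fourier u0"

text \<open>
  For \<open>q = deriv f\<close> this is the mean group velocity, at which the centre of the packet moves.
\<close>

definition mean :: "(real \<Rightarrow> real) \<Rightarrow> real" where
  "mean q = (LINT p|lborel. q p * (norm (g p))\<^sup>2) / (2 * pi)"

text \<open>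
  With \<open>q = 1\<close> this is minus the mean position at time 0, because the position operator acts as
  \<open>\<i> d/dp\<close> on spectra. With \<open>q = deriv f\<close> it is minus the symmetrised mean of position times velocity.
\<close>

definition cross :: "(real \<Rightarrow> real) \<Rightarrow> real" where
  "cross q = (LINT p|lborel. q p * Im (g' p * cnj (g p))) / (2 * pi)"

definition velocity_variance :: real where
  "velocity_variance = mean (\<lambda>p. (deriv f p)\<^sup>2) - (mean (deriv f))\<^sup>2"

lemma continuous_f [continuous_intros]: "continuous_on S f"
  by (intro continuous_at_imp_continuous_on ballI DERIV_isCont[OF f_deriv])

lemma continuous_deriv_f [continuous_intros]: "continuous_on S (deriv f)"
  by (intro continuous_at_imp_continuous_on ballI DERIV_isCont[OF f_deriv2])

lemma continuous_deriv2_f [continuous_intros]: "continuous_on S (deriv (deriv f))"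
  using continuous_on_subset[OF f_deriv2_continuous] by blast

lemma continuous_spectrum [continuous_intros]: "continuous_on S g"
  by (intro continuous_at_imp_continuous_on ballI has_vector_derivative_continuous[OF spectrum_deriv])

lemma continuous_spectrum_deriv [continuous_intros]: "continuous_on S g'"
  using continuous_on_subset[OF spectrum_deriv_continuous] by blast

lemma spectrum_deriv_support: "p \<notin> {a..b} \<Longrightarrow> g' p = 0"
  by (rule vector_derivative_zero_off_support[OF spectrum_deriv spectrum_support])

lemma integrable_weight: "continuous_on UNIV q \<Longrightarrow> integrable lborel (\<lambda>p. q p * (norm (g p))\<^sup>2)"
  by (rule compact_support_integrable[of _ a b])
    (auto intro!: continuous_intros simp: spectrum_support)

lemma integrable_cross: "continuous_on UNIV q \<Longrightarrow> integrable lborel (\<lambda>p. q p * Im (g' p * cnj (g p)))"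
  by (rule compact_support_integrable[of _ a b])
    (auto intro!: continuous_intros simp: spectrum_support simp del: times_complex.sel)

lemma integrable_spectrum_deriv: "integrable lborel (\<lambda>p. (norm (g' p))\<^sup>2)"
  by (rule compact_support_integrable[of _ a b])
    (auto intro!: continuous_intros simp: spectrum_deriv_support)

lemma mean_one: "mean (\<lambda>p. 1) = 1"
  using spectrum_mass by (simp add: mean_def)

lemma mean_add:
  "continuous_on UNIV q \<Longrightarrow> continuous_on UNIV r \<Longrightarrow> mean (\<lambda>p. q p + r p) = mean q + mean r"
  by (simp add: mean_def distrib_right integrable_weight add_divide_distrib)

lemma mean_cmult: "mean (\<lambda>p. c * q p) = c * mean q"
  by (simp add: mean_def mult.assoc)

lemma mean_square_affine:
  "mean (\<lambda>p. (c + s * deriv f p)\<^sup>2) = c\<^sup>2 + 2 * c * s * mean (deriv f) + s\<^sup>2 * mean (\<lambda>p. (deriv f p)\<^sup>2)"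
proof -
  have "(\<lambda>p. (c + s * deriv f p)\<^sup>2) = (\<lambda>p. c\<^sup>2 * 1 + (2 * c * s * deriv f p + s\<^sup>2 * (deriv f p)\<^sup>2))"
    by (auto simp: power2_eq_square algebra_simps)
  then have "mean (\<lambda>p. (c + s * deriv f p)\<^sup>2) =
      mean (\<lambda>p. c\<^sup>2 * 1 + (2 * c * s * deriv f p + s\<^sup>2 * (deriv f p)\<^sup>2))" by simp
  also have "\<dots> = mean (\<lambda>p. c\<^sup>2 * 1) + (mean (\<lambda>p. 2 * c * s * deriv f p) + mean (\<lambda>p. s\<^sup>2 * (deriv f p)\<^sup>2))"
    by (subst mean_add, (intro continuous_intros)+) (subst mean_add, (intro continuous_intros)+, simp)
  finally show ?thesis unfolding mean_cmult mean_one by simp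
qed

lemma strict_mono_deriv_f: "strict_mono (deriv f)"
  by (intro strict_monoI DERIV_pos_imp_increasing[of _ _ "deriv f"]) (use f_deriv2 f_convex in blast)+

lemma inj_deriv_f: "inj (deriv f)"
  by (rule strict_mono_imp_inj_on[OF strict_mono_deriv_f])

text \<open>
  The velocity \<open>deriv f\<close> is injective, so it equals its mean at one momentum at most, and a single
  momentum carries no mass.
\<close>

lemma velocity_variance_pos: "velocity_variance > 0"
proof -
  let ?m = "mean (deriv f)" and ?h = "\<lambda>p. (deriv f p - mean (deriv f))\<^sup>2 * (norm (g p))\<^sup>2"
  have i: "integrable lborel ?h" by (intro integrable_weight continuous_intros)
  have eq: "velocity_variance = (LINT p|lborel. ?h p) / (2 * pi)"
  proof -
    have "mean (\<lambda>p. (- ?m + 1 * deriv f p)\<^sup>2) = velocity_variance"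
      unfolding mean_square_affine velocity_variance_def by (simp add: power2_eq_square)
    then show ?thesis by (simp add: mean_def[of "\<lambda>p. (deriv f p - ?m)\<^sup>2"])
  qed
  have "(LINT p|lborel. ?h p) \<noteq> 0"
  proof
    assume "(LINT p|lborel. ?h p) = 0"
    then have z: "AE p in lborel. ?h p = 0"
      using integral_nonneg_eq_0_iff_AE[OF i] by simp
    \<comment> \<open>If no momentum travels at the mean velocity, any \<open>q\<close> will do.\<close>
    obtain q where q: "\<And>p. deriv f p = ?m \<Longrightarrow> p = q"
      using inj_deriv_f by (metis injD)
    from z AE_lborel_singleton[of q] have "AE p in lborel. (norm (g p))\<^sup>2 = 0"
      by eventually_elim (use q in auto)
    then have "(LINT p|lborel. (norm (g p))\<^sup>2) = 0" by (rule integral_eq_zero_AE)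
    then show False using spectrum_mass by simp
  qed
  moreover have "(LINT p|lborel. ?h p) \<ge> 0" by (intro integral_nonneg_AE) auto
  ultimately have "(LINT p|lborel. ?h p) > 0" by linarith
  then show ?thesis unfolding eq by simp
qed

section \<open>Variance of the wave packet\<close>

lemma wave_packet_eq_fourier:
  "wave_packet f u0 t x = of_real (1 / (2 * pi)) * fourier (\<lambda>p. g p * cis (- (t * f p))) (- x)"
proof -
  have "(\<lambda>p. g p * cis (- (t * f p) + x * p)) = (\<lambda>p. g p * cis (- (t * f p)) * cis (- (p * - x)))"
    by (simp only: mult.assoc cis_mult) (simp add: mult.commute)
  then show ?thesis
    unfolding wave_packet_def fourier_def[of "\<lambda>p. g p * cis (- (t * f p))"] by simp
qed

lemma norm_wave_packet:
  "(norm (wave_packet f u0 t x))\<^sup>2 =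
    (norm (fourier (\<lambda>p. g p * cis (- (t * f p))) (- x)))\<^sup>2 / (4 * pi\<^sup>2)"
  unfolding wave_packet_eq_fourier by (simp add: norm_mult norm_divide power_mult_distrib power_divide)

text \<open>
  The propagator multiplies the spectrum by a phase, so the \<open>L\<^sup>2\<close> norm is conserved.
\<close>

lemma wave_packet_mass:
  "has_bochner_integral lborel (\<lambda>x. (norm (wave_packet f u0 t x))\<^sup>2) 1"
proof -
  let ?G = "\<lambda>p. g p * cis (- (t * f p))"
  have cG: "continuous_on UNIV ?G" by (intro continuous_intros)
  have zG: "?G p = 0" if "p \<notin> {a..b}" for p using spectrum_support[OF that] by simp
  obtain B where B: "\<And>p. norm (?G p) \<le> B" using compact_support_bounded[OF cG zG] by blast
  have "has_bochner_integral lborel (\<lambda>\<xi>. (norm (fourier ?G \<xi>))\<^sup>2) (2 * pi * (2 * pi))"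
    using plancherel[OF compact_support_integrable[OF cG zG] cG B] spectrum_mass
    by (simp add: norm_mult)
  then have "has_bochner_integral lborel (\<lambda>x. (norm (fourier ?G (0 + - 1 * x)))\<^sup>2) ((2 * pi * (2 * pi)) /\<^sub>R \<bar>- 1\<bar>)"
    by (subst (asm) lborel_has_bochner_integral_real_affine_iff[where c = "- 1" and t = 0]) auto
  from has_bochner_integral_divide_zero[OF this, of "4 * pi\<^sup>2"]
  show ?thesis unfolding norm_wave_packet by (simp add: power2_eq_square)
qed

lemma norm_add_i_mult_square:
  "(norm (z + \<i> * of_real r * w))\<^sup>2 = (norm z)\<^sup>2 + (2 * r * Im (z * cnj w) + r\<^sup>2 * (norm w)\<^sup>2)"
  unfolding cmod_power2 by (simp add: power2_eq_square algebra_simps)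

text \<open>
  In the spectrum, \<open>c - x\<close> acts as \<open>c - \<i> d/dp\<close>, and conjugation by the phase \<open>cis (- (t * f p))\<close>
  adds \<open>- t * deriv f p\<close> to it. Plancherel therefore turns the left-hand side into the integral of
  \<open>|g' + \<i> (c - t f') g|\<^sup>2 / (2 * pi)\<close>, which is expanded here.
\<close>

lemma wave_packet_second_moment_about:
  "has_bochner_integral lborel (\<lambda>x. (c - x)\<^sup>2 * (norm (wave_packet f u0 t x))\<^sup>2)
    ((LINT p|lborel. (norm (g' p))\<^sup>2) / (2 * pi)
      + 2 * (c * cross (\<lambda>p. 1) - t * cross (deriv f)) + mean (\<lambda>p. (c - t * deriv f p)\<^sup>2))"
proof -
  let ?G = "\<lambda>p. g p * cis (- (t * f p))"
  let ?G' = "\<lambda>p. (g' p - \<i> * of_real (t * deriv f p) * g p) * cis (- (t * f p))"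
  have d: "(?G has_vector_derivative ?G' p) (at p)" for p
    by (rule derivative_eq_intros spectrum_deriv has_vector_derivative_cis f_deriv refl)+
      (simp add: algebra_simps)
  have c: "continuous_on UNIV ?G'" by (intro continuous_intros)
  have z: "?G p = 0" if "p \<notin> {a..b}" for p using spectrum_support[OF that] by simp
  have n: "(norm (?G' p + \<i> * of_real c * ?G p))\<^sup>2 = (norm (g' p))\<^sup>2 +
      (2 * ((c - t * deriv f p) * Im (g' p * cnj (g p))) + (c - t * deriv f p)\<^sup>2 * (norm (g p))\<^sup>2)" for p
  proof -
    have "?G' p + \<i> * of_real c * ?G p = (g' p + \<i> * of_real (c - t * deriv f p) * g p) * cis (- (t * f p))"
      by (simp add: algebra_simps)
    then have "norm (?G' p + \<i> * of_real c * ?G p) = norm (g' p + \<i> * of_real (c - t * deriv f p) * g p)"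
      by (simp add: norm_mult)
    then show ?thesis unfolding norm_add_i_mult_square[symmetric] mult.assoc[symmetric] by simp
  qed
  have x: "(LINT p|lborel. (c - t * deriv f p) * Im (g' p * cnj (g p)))
      = 2 * pi * (c * cross (\<lambda>p. 1) - t * cross (deriv f))"
  proof -
    have "(LINT p|lborel. (c - t * deriv f p) * Im (g' p * cnj (g p)))
        = (LINT p|lborel. c * (1 * Im (g' p * cnj (g p))) - t * (deriv f p * Im (g' p * cnj (g p))))"
      by (simp only: left_diff_distrib mult.assoc mult_1)
    also have "\<dots> = c * (LINT p|lborel. 1 * Im (g' p * cnj (g p))) - t * (LINT p|lborel. deriv f p * Im (g' p * cnj (g p)))"
    proof -
      have 1: "integrable lborel (\<lambda>p. c * (1 * Im (g' p * cnj (g p))))"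
        by (intro integrable_mult_right integrable_cross continuous_intros)
      have 2: "integrable lborel (\<lambda>p. t * (deriv f p * Im (g' p * cnj (g p))))"
        by (intro integrable_mult_right integrable_cross continuous_intros)
      show ?thesis
        unfolding Bochner_Integration.integral_diff[OF 1 2] integral_mult_right_zero ..
    qed
    finally show ?thesis unfolding cross_def by (simp add: right_diff_distrib)
  qed
  have "(LINT p|lborel. (norm (?G' p + \<i> * of_real c * ?G p))\<^sup>2) =
      (LINT p|lborel. (norm (g' p))\<^sup>2) + (2 * (LINT p|lborel. (c - t * deriv f p) * Im (g' p * cnj (g p)))
        + (LINT p|lborel. (c - t * deriv f p)\<^sup>2 * (norm (g p))\<^sup>2))"
  proof -
    have 1: "integrable lborel (\<lambda>p. 2 * ((c - t * deriv f p) * Im (g' p * cnj (g p))))"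
      by (intro integrable_mult_right integrable_cross continuous_intros)
    have 2: "integrable lborel (\<lambda>p. (c - t * deriv f p)\<^sup>2 * (norm (g p))\<^sup>2)"
      by (intro integrable_weight continuous_intros)
    show ?thesis
      unfolding n Bochner_Integration.integral_add[OF integrable_spectrum_deriv Bochner_Integration.integrable_add[OF 1 2]]
        Bochner_Integration.integral_add[OF 1 2] integral_mult_right_zero ..
  qed
  also have "\<dots> = 2 * pi * ((LINT p|lborel. (norm (g' p))\<^sup>2) / (2 * pi)
      + 2 * (c * cross (\<lambda>p. 1) - t * cross (deriv f)) + mean (\<lambda>p. (c - t * deriv f p)\<^sup>2))" (is "_ = _ * ?R")
    unfolding x mean_def by (simp add: algebra_simps)
  finally have I: "(LINT p|lborel. (norm (?G' p + \<i> * of_real c * ?G p))\<^sup>2) = 2 * pi * ?R" .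
  have "has_bochner_integral lborel (\<lambda>\<xi>. (\<xi> + c)\<^sup>2 * (norm (fourier ?G \<xi>))\<^sup>2) (2 * pi * (2 * pi * ?R))"
    unfolding I[symmetric] by (rule plancherel_weighted[OF d c z])
  then have "has_bochner_integral lborel (\<lambda>x. (0 + - 1 * x + c)\<^sup>2 * (norm (fourier ?G (0 + - 1 * x)))\<^sup>2)
      ((2 * pi * (2 * pi * ?R)) /\<^sub>R \<bar>- 1\<bar>)"
    by (subst (asm) lborel_has_bochner_integral_real_affine_iff[where c = "- 1" and t = 0]) auto
  from has_bochner_integral_divide_zero[OF this, of "4 * pi\<^sup>2"]
  have "has_bochner_integral lborel (\<lambda>x. (0 + - 1 * x + c)\<^sup>2 * (norm (fourier ?G (0 + - 1 * x)))\<^sup>2 / (4 * pi\<^sup>2)) ?R"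
    by (simp add: power2_eq_square)
  then show ?thesis by (simp add: norm_wave_packet)
qed

lemma wave_packet_moment2:
  "has_bochner_integral lborel (\<lambda>x. x\<^sup>2 * (norm (wave_packet f u0 t x))\<^sup>2)
    ((LINT p|lborel. (norm (g' p))\<^sup>2) / (2 * pi)
      - 2 * t * cross (deriv f) + t\<^sup>2 * mean (\<lambda>p. (deriv f p)\<^sup>2))"
  using wave_packet_second_moment_about[of 0 t] mean_square_affine[of 0 "- t"] by (simp add: mult.assoc)

text \<open>
  The identity \<open>2 x = 1 + x\<^sup>2 - (1 - x)\<^sup>2\<close> reduces the first moment to the total mass and to second
  moments about 0 and 1; it also yields integrability.
\<close>

lemma wave_packet_moment1:
  "has_bochner_integral lborel (\<lambda>x. x * (norm (wave_packet f u0 t x))\<^sup>2) (t * mean (deriv f) - cross (\<lambda>p. 1))"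
proof -
  let ?w = "\<lambda>x. (norm (wave_packet f u0 t x))\<^sup>2"
  let ?N = "(LINT p|lborel. (norm (g' p))\<^sup>2) / (2 * pi)"
  let ?m = "mean (\<lambda>p. (deriv f p)\<^sup>2)"
  have "has_bochner_integral lborel (\<lambda>x. ((?w x + x\<^sup>2 * ?w x) - (1 - x)\<^sup>2 * ?w x) / 2)
      (((1 + (?N - 2 * t * cross (deriv f) + t\<^sup>2 * ?m))
        - (?N + 2 * (1 * cross (\<lambda>p. 1) - t * cross (deriv f)) + mean (\<lambda>p. (1 - t * deriv f p)\<^sup>2))) / 2)"
    by (intro has_bochner_integral_divide_zero has_bochner_integral_diff has_bochner_integral_add
        wave_packet_mass wave_packet_moment2 wave_packet_second_moment_about)
  moreover have "mean (\<lambda>p. (1 - t * deriv f p)\<^sup>2) = 1 - 2 * t * mean (deriv f) + t\<^sup>2 * ?m"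
    using mean_square_affine[of 1 "- t"] by simp
  moreover have "((w + x\<^sup>2 * w) - (1 - x)\<^sup>2 * w) / 2 = x * w" for x w :: real
    by (simp add: power2_eq_square algebra_simps)
  moreover have "(2 * t * mean (deriv f) - 2 * cross (\<lambda>p. 1)) / 2 = t * mean (deriv f) - cross (\<lambda>p. 1)"
    by simp
  ultimately show ?thesis by simp
qed

lemma variance_wave_packet:
  "variance (wave_packet f u0 t) = variance (wave_packet f u0 0)
    + 2 * t * (mean (deriv f) * cross (\<lambda>p. 1) - cross (deriv f)) + t\<^sup>2 * velocity_variance"
proof -
  have "variance (wave_packet f u0 t) = (LINT p|lborel. (norm (g' p))\<^sup>2) / (2 * pi)
      - 2 * t * cross (deriv f) + t\<^sup>2 * mean (\<lambda>p. (deriv f p)\<^sup>2) - (t * mean (deriv f) - cross (\<lambda>p. 1))\<^sup>2" for t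
    unfolding variance_def moment1_def moment2_def
    by (simp only: has_bochner_integral_integral_eq[OF wave_packet_moment1]
        has_bochner_integral_integral_eq[OF wave_packet_moment2])
  from this[of t] this[of 0] show ?thesis
    by (simp add: velocity_variance_def power2_eq_square algebra_simps)
qed

section \<open>Variance of the first-order term H\<close>

text \<open>
  The substitution \<open>y = deriv f p\<close>. It is carried out on \<open>[a, b]\<close>, where the inverse of \<open>deriv f\<close> is
  continuous by compactness; the integrand vanishes outside \<open>[deriv f a, deriv f b]\<close>. The Jacobian
  \<open>deriv (deriv f) p\<close> cancels the denominator.
\<close>

lemma integral_velocity_substitution:
  fixes h :: "real \<Rightarrow> real"
  assumes h: "continuous_on UNIV h"
  shows "(LINT y|lborel. h y * (if y \<in> range (deriv f)
      then (norm (g (inv (deriv f) y)))\<^sup>2 / deriv (deriv f) (inv (deriv f) y) else 0))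
    = 2 * pi * mean (\<lambda>p. h (deriv f p))"
proof -
  let ?v = "deriv f" and ?i = "inv (deriv f)"
  let ?W = "\<lambda>y. (norm (g (?i y)))\<^sup>2 / deriv ?v (?i y)"
  let ?F = "\<lambda>y. h y * (if y \<in> range ?v then ?W y else 0)"
  have iv [simp]: "?i (?v p) = p" for p using inj_deriv_f by (rule inv_f_f)
  have le_iff: "?v p \<le> ?v q \<longleftrightarrow> p \<le> q" for p q
    by (rule strict_mono_less_eq[OF strict_mono_deriv_f])
  have img: "?v ` {a..b} = {?v a..?v b}"
  proof
    show "?v ` {a..b} \<subseteq> {?v a..?v b}" by (auto simp: le_iff)
    show "{?v a..?v b} \<subseteq> ?v ` {a..b}"
    proof
      fix y assume "y \<in> {?v a..?v b}"
      then obtain p where "a \<le> p" "p \<le> b" "?v p = y"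
        using IVT'[of ?v a y b] ab continuous_deriv_f by auto
      then show "y \<in> ?v ` {a..b}" by auto
    qed
  qed
  have ci: "continuous_on {?v a..?v b} ?i"
    unfolding img[symmetric] by (rule continuous_on_inv) (auto intro: continuous_deriv_f)
  have "continuous_on {?v a..?v b} (\<lambda>y. h y * ?W y)"
    by (intro continuous_intros continuous_on_subset[OF h]
        continuous_on_compose2[OF continuous_spectrum ci] continuous_on_compose2[OF continuous_deriv2_f ci])
      (use f_convex in \<open>auto simp: less_imp_neq[symmetric]\<close>)
  also have "?this \<longleftrightarrow> continuous_on {?v a..?v b} ?F"
    by (intro continuous_on_cong refl) (use img in \<open>auto dest: equalityD2[THEN subsetD]\<close>)
  finally have "set_integrable lborel {?v a..?v b} ?F" by (rule borel_integrable_atLeastAtMost')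
  then have "(LINT y|lborel. ?F y * indicator {?v a..?v b} y)
      = (LINT p|lborel. ?F (?v p) * deriv ?v p * indicator {a..b} p)"
    by (rule integral_substitution(2)) (use f_deriv2 f_convex ab in \<open>auto intro: less_imp_le continuous_deriv2_f\<close>)
  also have "(\<lambda>p. ?F (?v p) * deriv ?v p * indicator {a..b} p) = (\<lambda>p. h (?v p) * (norm (g p))\<^sup>2)"
  proof
    fix p
    have "deriv ?v p \<noteq> 0" using f_convex[of p] by simp
    then show "?F (?v p) * deriv ?v p * indicator {a..b} p = h (?v p) * (norm (g p))\<^sup>2"
      by (cases "p \<in> {a..b}") (auto simp: spectrum_support)
  qed
  also have "(\<lambda>y. ?F y * indicator {?v a..?v b} y) = ?F"
  proof
    fix y show "?F y * indicator {?v a..?v b} y = ?F y"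
      by (cases "y \<in> range ?v") (auto simp: indicator_def le_iff intro!: spectrum_support)
  qed
  finally show ?thesis by (simp add: mean_def)
qed

lemma norm_H:
  assumes t: "t \<noteq> t0"
  shows "(norm (H f t x u0 t0 x0))\<^sup>2 = (if (x - x0) / (t - t0) \<in> range (deriv f)
      then (norm (g (inv (deriv f) ((x - x0) / (t - t0)))))\<^sup>2
        / deriv (deriv f) (inv (deriv f) ((x - x0) / (t - t0))) else 0) / (2 * pi * \<bar>t - t0\<bar>)"
proof -
  have "(\<bar>t - t0\<bar> powr (- 1 / 2))\<^sup>2 = 1 / \<bar>t - t0\<bar>"
    using t by (simp add: power2_eq_square powr_add[symmetric] powr_minus_divide)
  then show ?thesis
    using f_convex
    by (simp add: H_def Let_def norm_mult norm_divide power_mult_distrib power_divide less_imp_le)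
qed

text \<open>
  The density \<open>|H|\<^sup>2\<close> at time \<open>t\<close> is the momentum density transported along the rays
  \<open>x = x0 + (t - t0) * deriv f p\<close>, all of which leave the point \<open>x0\<close> at time \<open>t0\<close>.
\<close>

lemma moment_H:
  fixes h :: "real \<Rightarrow> real"
  assumes t: "t \<noteq> t0" and h: "continuous_on UNIV h"
  shows "(LINT x|lborel. h x * (norm (H f t x u0 t0 x0))\<^sup>2) = mean (\<lambda>p. h (x0 + (t - t0) * deriv f p))"
proof -
  let ?W = "\<lambda>y. if y \<in> range (deriv f)
      then (norm (g (inv (deriv f) y)))\<^sup>2 / deriv (deriv f) (inv (deriv f) y) else 0"
  have "(LINT x|lborel. h x * (norm (H f t x u0 t0 x0))\<^sup>2)
      = \<bar>t - t0\<bar> *\<^sub>R (LINT y|lborel. h (x0 + (t - t0) * y) * (norm (H f t (x0 + (t - t0) * y) u0 t0 x0))\<^sup>2)"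
    using t by (intro lborel_integral_real_affine) simp
  also have "\<dots> = \<bar>t - t0\<bar> * (LINT y|lborel. h (x0 + (t - t0) * y) * ?W y / (2 * pi * \<bar>t - t0\<bar>))"
    unfolding norm_H[OF t] using t by (simp cong: if_cong)
  also have "\<dots> = \<bar>t - t0\<bar> * ((LINT y|lborel. h (x0 + (t - t0) * y) * ?W y) / (2 * pi * \<bar>t - t0\<bar>))"
    by (simp only: integral_divide_zero)
  also have "\<dots> = mean (\<lambda>p. h (x0 + (t - t0) * deriv f p))"
    by (subst integral_velocity_substitution)
      (use t in \<open>auto intro!: continuous_intros continuous_on_compose2[OF h]\<close>)
  finally show ?thesis .
qed

text \<open>
  All rays start at the same point, so the spread of positions is \<open>t - t0\<close> times the spread of
  velocities: the parabola has its vertex at \<open>t0\<close>, with vertex value 0.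
\<close>

lemma variance_H:
  assumes t: "t \<noteq> t0"
  shows "variance (\<lambda>x. H f t x u0 t0 x0) = (t - t0)\<^sup>2 * velocity_variance"
proof -
  have "moment1 (\<lambda>x. H f t x u0 t0 x0) = mean (\<lambda>p. x0 * 1 + (t - t0) * deriv f p)"
    unfolding moment1_def using moment_H[OF t, of "\<lambda>x. x"] by simp
  also have "\<dots> = x0 + (t - t0) * mean (deriv f)"
    by (subst mean_add, (intro continuous_intros)+) (unfold mean_cmult mean_one, simp)
  finally have m1: "moment1 (\<lambda>x. H f t x u0 t0 x0) = x0 + (t - t0) * mean (deriv f)" .
  have m2: "moment2 (\<lambda>x. H f t x u0 t0 x0) = mean (\<lambda>p. (x0 + (t - t0) * deriv f p)\<^sup>2)"
    unfolding moment2_def by (rule moment_H[OF t]) (intro continuous_intros)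
  show ?thesis
    unfolding variance_def m1 m2 mean_square_affine velocity_variance_def
    by (simp add: power2_eq_square algebra_simps)
qed

end

section \<open>Comparison of the two parabolas\<close>

lemma quadratic_unique_minimum:
  fixes \<alpha> \<beta> \<sigma> :: real
  assumes "\<sigma> > 0"
  shows "is_arg_min (\<lambda>t. \<alpha> + 2 * t * \<beta> + t\<^sup>2 * \<sigma>) (\<lambda>_. True) t \<longleftrightarrow> t = - \<beta> / \<sigma>"
proof -
  have eq: "\<alpha> + 2 * t * \<beta> + t\<^sup>2 * \<sigma> = (\<alpha> - \<beta>\<^sup>2 / \<sigma>) + \<sigma> * (t + \<beta> / \<sigma>)\<^sup>2" for t
    using assms by (simp add: field_simps power2_eq_square)
  show ?thesis
  proof
    assume "is_arg_min (\<lambda>t. \<alpha> + 2 * t * \<beta> + t\<^sup>2 * \<sigma>) (\<lambda>_. True) t"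
    then have "\<forall>y. \<sigma> * (t + \<beta> / \<sigma>)\<^sup>2 \<le> \<sigma> * (y + \<beta> / \<sigma>)\<^sup>2"
      unfolding eq is_arg_min_linorder by simp
    from this[rule_format, of "- \<beta> / \<sigma>"] have "t + \<beta> / \<sigma> = 0" using assms by (simp add: mult_le_0_iff)
    then show "t = - \<beta> / \<sigma>" by simp
  next
    assume "t = - \<beta> / \<sigma>"
    then show "is_arg_min (\<lambda>t. \<alpha> + 2 * t * \<beta> + t\<^sup>2 * \<sigma>) (\<lambda>_. True) t"
      unfolding eq is_arg_min_linorder using assms by simp
  qed
qed

lemma symbol_derivatives:
  assumes "symbol f"
  shows "(f has_real_derivative deriv f p) (at p)"
    and "(deriv f has_real_derivative deriv (deriv f) p) (at p)"
    and "continuous_on UNIV (deriv (deriv f))"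
    and "deriv (deriv f) p > 0"
proof -
  have d: "(deriv ^^ n) f differentiable (at x)" for n x
    using assms unfolding symbol_def by blast
  have "f differentiable (at x)" "deriv f differentiable (at x)"
    "deriv (deriv f) differentiable (at x)" for x
    using d[of 0 x] d[of 1 x] d[of 2 x] by (simp_all add: numeral_2_eq_2)
  then show "(f has_real_derivative deriv f p) (at p)"
    "(deriv f has_real_derivative deriv (deriv f) p) (at p)"
    "continuous_on UNIV (deriv (deriv f))"
    by (auto simp: DERIV_deriv_iff_real_differentiable
        intro!: continuous_at_imp_continuous_on differentiable_imp_continuous_within)
  show "deriv (deriv f) p > 0" using assms by (simp add: symbol_def)
qed

theorem proposition4p5:
  fixes p1 p2 t0 x0 :: real
    and f :: "real \<Rightarrow> real"
    and u0 :: "real \<Rightarrow> complex"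
  assumes "p1 < p2"
    and "symbol f"
    and "schwartz u0"
    and "supp (fourier u0) \<subseteq> {p1..p2}"
    and "L2norm u0 = 1"
  shows "(\<exists>!\<tau>. is_arg_min (\<lambda>\<tau>. variance (wave_packet f u0 \<tau>)) (\<lambda>_. True) \<tau>) \<and>
    ((\<exists>C. \<forall>t. t \<noteq> t0 \<longrightarrow>
          variance (wave_packet f u0 t) - variance (\<lambda>x. H f t x u0 t0 x0) = C)
       \<longleftrightarrow> t0 = arg_min (\<lambda>\<tau>. variance (wave_packet f u0 \<tau>)) (\<lambda>_. True)) \<and>
    (\<forall>C. (\<forall>t. t \<noteq> t0 \<longrightarrow>
          variance (wave_packet f u0 t) - variance (\<lambda>x. H f t x u0 t0 x0) = C)
       \<longrightarrow> C \<in> range (\<lambda>\<tau>. variance (wave_packet f u0 \<tau>)) \<and>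
           (\<forall>\<tau>. C \<le> variance (wave_packet f u0 \<tau>)))"
proof -
  obtain g' where g': "\<And>p. (fourier u0 has_vector_derivative g' p) (at p)" "continuous_on UNIV g'"
    using schwartz_fourier_C1[OF assms(3)] by blast
  have support: "fourier u0 p = 0" if "p \<notin> {p1..p2}" for p
    using assms(4) that closure_subset[of "{p. fourier u0 p \<noteq> 0}"] unfolding supp_def by blast
  have mass: "(LINT p|lborel. (norm (fourier u0 p))\<^sup>2) = 2 * pi"
  proof -
    have i: "integrable lborel u0" using schwartz_weighted_integrable[OF assms(3), of 0] by simp
    obtain B where B: "\<And>x. norm (u0 x) \<le> B"
      using schwartz_weighted_bounded[OF assms(3), of 0] by auto
    have "(LINT x|lborel. (norm (u0 x))\<^sup>2) = 1" using assms(5) by (simp add: L2norm_def)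
    then show ?thesis
      using has_bochner_integral_integral_eq[OF plancherel[OF i schwartz_continuous[OF assms(3)] B]] by simp
  qed
  interpret wave_packet_spectrum f u0 g' p1 p2
    by unfold_locales
      (use symbol_derivatives[OF assms(2)] g' support mass assms(1) in auto)
  define \<alpha> where "\<alpha> = variance (wave_packet f u0 0)"
  define \<beta> where "\<beta> = mean (deriv f) * cross (\<lambda>p. 1) - cross (deriv f)"
  let ?\<sigma> = velocity_variance
  have \<sigma>: "?\<sigma> > 0" by (rule velocity_variance_pos)
  have V: "variance (wave_packet f u0 t) = \<alpha> + 2 * t * \<beta> + t\<^sup>2 * ?\<sigma>" for t
    using variance_wave_packet[of t] by (simp add: \<alpha>_def \<beta>_def)
  have is_arg_min_iff: "is_arg_min (\<lambda>\<tau>. variance (wave_packet f u0 \<tau>)) (\<lambda>_. True) t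
      \<longleftrightarrow> t = - \<beta> / ?\<sigma>" for t
    unfolding V by (rule quadratic_unique_minimum[OF \<sigma>])
  have arg_min: "arg_min (\<lambda>\<tau>. variance (wave_packet f u0 \<tau>)) (\<lambda>_. True) = - \<beta> / ?\<sigma>"
    unfolding arg_min_def is_arg_min_iff by simp
  have diff: "variance (wave_packet f u0 t) - variance (\<lambda>x. H f t x u0 t0 x0)
      = \<alpha> - t0\<^sup>2 * ?\<sigma> + 2 * t * (\<beta> + t0 * ?\<sigma>)" if "t \<noteq> t0" for t
    unfolding V variance_H[OF that] by (simp add: power2_eq_square algebra_simps)
  have const: "t0 = - \<beta> / ?\<sigma> \<and> C = \<alpha> + 2 * t0 * \<beta> + t0\<^sup>2 * ?\<sigma>"
    if "\<forall>t. t \<noteq> t0 \<longrightarrow> variance (wave_packet f u0 t) - variance (\<lambda>x. H f t x u0 t0 x0) = C" for C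
  proof -
    \<comment> \<open>Two times other than \<open>t0\<close> force the slope \<open>2 * D\<close> of the difference to vanish.\<close>
    define D where "D = \<beta> + t0 * ?\<sigma>"
    have eq: "\<alpha> - t0\<^sup>2 * ?\<sigma> + 2 * (t0 + 1) * D = C" "\<alpha> - t0\<^sup>2 * ?\<sigma> + 2 * (t0 + 2) * D = C"
      using that diff[of "t0 + 1"] diff[of "t0 + 2"] by (simp_all add: D_def)
    have D: "D = 0" using eq by (simp add: algebra_simps)
    have C: "C = \<alpha> - t0\<^sup>2 * ?\<sigma>" using eq(1) D by simp
    have \<beta>: "\<beta> = - (t0 * ?\<sigma>)" using D unfolding D_def by simp
    have "t0 = - \<beta> / ?\<sigma>" unfolding \<beta> using \<sigma> by simp
    moreover have "C = \<alpha> + 2 * t0 * \<beta> + t0\<^sup>2 * ?\<sigma>"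
      unfolding C \<beta> by (simp add: power2_eq_square)
    ultimately show ?thesis ..
  qed
  show ?thesis
  proof (intro conjI allI impI)
    show "\<exists>!\<tau>. is_arg_min (\<lambda>\<tau>. variance (wave_packet f u0 \<tau>)) (\<lambda>_. True) \<tau>"
      unfolding is_arg_min_iff by simp
    show "(\<exists>C. \<forall>t. t \<noteq> t0 \<longrightarrow>
          variance (wave_packet f u0 t) - variance (\<lambda>x. H f t x u0 t0 x0) = C)
       \<longleftrightarrow> t0 = arg_min (\<lambda>\<tau>. variance (wave_packet f u0 \<tau>)) (\<lambda>_. True)"
      unfolding arg_min
    proof
      assume "\<exists>C. \<forall>t. t \<noteq> t0 \<longrightarrow>
          variance (wave_packet f u0 t) - variance (\<lambda>x. H f t x u0 t0 x0) = C"
      then obtain C where "\<forall>t. t \<noteq> t0 \<longrightarrow>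
          variance (wave_packet f u0 t) - variance (\<lambda>x. H f t x u0 t0 x0) = C" ..
      then show "t0 = - \<beta> / ?\<sigma>" by (rule const[THEN conjunct1])
    next
      assume "t0 = - \<beta> / ?\<sigma>"
      then have "\<beta> + t0 * ?\<sigma> = 0" using \<sigma> by simp
      then show "\<exists>C. \<forall>t. t \<noteq> t0 \<longrightarrow>
          variance (wave_packet f u0 t) - variance (\<lambda>x. H f t x u0 t0 x0) = C"
        by (intro exI[of _ "\<alpha> - t0\<^sup>2 * ?\<sigma>"]) (simp add: diff)
    qed
  next
    fix C
    assume "\<forall>t. t \<noteq> t0 \<longrightarrow> variance (wave_packet f u0 t) - variance (\<lambda>x. H f t x u0 t0 x0) = C"
    from const[OF this] have t0: "t0 = - \<beta> / ?\<sigma>" and C: "C = variance (wave_packet f u0 t0)"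
      unfolding V by (rule conjunct1, rule conjunct2)
    show "C \<in> range (\<lambda>\<tau>. variance (wave_packet f u0 \<tau>))" unfolding C by (rule rangeI)
    from t0 have "is_arg_min (\<lambda>\<tau>. variance (wave_packet f u0 \<tau>)) (\<lambda>_. True) t0"
      unfolding is_arg_min_iff .
    then show "C \<le> variance (wave_packet f u0 \<tau>)" for \<tau>
      unfolding C is_arg_min_linorder by blast
  qed
qed

end
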